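(* In the setting of the context ($f$ possibly nonconvex, constant step-size $\gamma$, randomized block selection rule), let $\epsilon>0$ and define $T_\epsilon$ to be the first $r\ge 0$ such that $\mathbb{E}[\|\widetilde\nabla h(x^r)\|^2]\le\epsilon$. Then $$T_\epsilon\le\frac{\kappa}{\epsilon},\qquad \kappa:=\frac{2(L^2+2L+2)\,(h(x^0)-h^* )}{\widehat\beta},$$ where $h^*=\min_{x\in\mathcal{X}}h(x)$ and $L=\max_i L_i$.
   Context: Problem: minimize $h(x)=f(x_1,\dots,x_n)+\sum_{i=1}^n g_i(x_i)$ subject to $x_i\in\mathcal{X}_i$, $i=1,\dots,n$, where each $\mathcal{X}_i\subseteq\mathbb{R}^{m_i}$ is a (nonempty) closed convex set, $\mathcal{X}=\prod_{i=1}^n\mathcal{X}_i$, $f:\mathcal{X}\to\mathbb{R}$ is continuously differentiable (possibly nonconvex), each $g_i:\mathbb{R}^{m_i}\to\mathbb{R}$ is convex (possibly nonsmooth), and $g(x)=\sum_i g_i(x_i)$. $\|\cdot\|$ is the Euclidean norm. Assume $\|\nabla f(x)-\nabla f(y)\|\le L_{\nabla f}\|x-y\|$ for all $x,y\in\mathcal{X}$, and $\inf_{x\in\mathcal{X}}h(x)>-\infty$ (if the minimum of $h$ is not attained, $h^*$ is understood as the infimum). Approximations: for each $i$ a function $\widetilde f_i:\mathcal{X}_i\times\mathcal{X}\to\mathbb{R}$ is given such that (1) $\widetilde f_i(\cdot,y)$ is continuously differentiable and uniformly strongly convex with parameter $\tau>0$: $\widetilde f_i(x_i,y)\ge\widetilde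 f_i(x_i',y)+\langle\nabla_{x_i}\widetilde f_i(x_i',y),x_i-x_i'\rangle+\frac{\tau}{2}\|x_i-x_i'\|^2$ for all $x_i,x_i'\in\mathcal{X}_i$, $y\in\mathcal{X}$; (2) (gradient consistency) $\nabla_{x_i}\widetilde f_i(x_i,x)=\nabla_{x_i}f(x)$ for all $x\in\mathcal{X}$, where $x_i$ is the $i$-th block of $x$ and the gradient of $\widetilde f_i$ is with respect to its first argument; (3) $\|\nabla_{x_i}\widetilde f_i(x_i,y)-\nabla_{x_i}\widetilde f_i(x_i,z)\|\le\widetilde L\|y-z\|$ for all $y,z\in\mathcal{X}$, $x_i\in\mathcal{X}_i$, and all $i$; (4) $\|\nabla_{x_i}\widetilde f_i(x_i,y)-\nabla_{x_i}\widetilde f_i(x_i',y)\|\le L_i\|x_i-x_i'\|$ for all $x_i,x_i'\in\mathcal{X}_i$, $y\in\mathcal{X}$, and all $i$. Put $\widetilde h_i(x_i,y)=\widetilde f_i(x_i,y)+g_i(x_i)$. PSCA algorithm with randomized rule and constant step-size: start from a (deterministic) feasible $x^0\in\mathcal{X}$. For $r=0,1,2,\dots$: choose a random $S^r\subseteq\{1,\dots,n\}$ with $\Pr(j\in S^r\mid x^r,x^{r-1},\dots,x^0)=p_j^r\ge p_{\min}>0$ for all $j$; let $\hat x_i^r=\arg\min_{x_i\in\mathcal{X}_i}\widetilde h_i(x_i,x^r)$ for $i=1,\dots,n$ and $\hat x^r=(\hat x_i^r)_{i=1}^n$; set $x_i^{r+1}=x_i^r+\gamma(\hat x_i^r-x_i^r)$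 for $i\in S^r$ and $x_i^{r+1}=x_i^r$ for $i\notin S^r$. The constant step-size $\gamma\in(0,1]$ satisfies $\gamma<\tau/L_{\nabla f}$. Constant $\widehat\beta$: $\widehat\beta>0$ is a constant (which exists because $\gamma<\tau/L_{\nabla f}$) such that $\mathbb{E}[h(x^{r+1})\mid x^r]\le h(x^r)-\widehat\beta\|\hat x^r-x^r\|^2$ for all $r\ge 0$. Proximal gradient of the objective: for $x\in\mathcal{X}$, $$\widetilde\nabla h(x)=x-\arg\min_{y\in\mathcal{X}}\left\{\langle\nabla f(x),y-x\rangle+g(y)+\tfrac12\|y-x\|^2\right\}.$$ *)

theory Defs
  imports "HOL-Probability.Probability"
begin

(* The n blocks are indexed by a finite type 'n.  To let the block dimensions m_i differ,
   R^{m_i} is an arbitrary linear subspace V i, of dimension m_i, of one common Euclidean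
   space 'a.  A point (x_1, ..., x_n) is x :: 'a^'n with blocks x $ i; the norm and the inner
   product of 'a^'n are the Euclidean ones of the product. *)

definition block_prod :: "('n::finite \<Rightarrow> 'a set) \<Rightarrow> ('a ^ 'n) set" where
  "block_prod X = {x. \<forall>i. x $ i \<in> X i}"

(* S is a closed convex set, possibly without interior, and f only matters on S, so
   derivatives are taken within S.  V is the space in which the gradients live. *)
definition continuously_differentiable_with_gradient ::
    "'b::euclidean_space set \<Rightarrow> 'b set \<Rightarrow> ('b \<Rightarrow> real) \<Rightarrow> ('b \<Rightarrow> 'b) \<Rightarrow> bool" where
  "continuously_differentiable_with_gradient V S f Df \<longleftrightarrow>
     (\<forall>x\<in>S. Df x \<in> V \<and> (f has_derivative (\<lambda>v. Df x \<bullet> v)) (at x within S)) \<and>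
     continuous_on S Df"

definition separable_sum :: "('n::finite \<Rightarrow> 'a \<Rightarrow> real) \<Rightarrow> 'a ^ 'n \<Rightarrow> real" where
  "separable_sum g x = (\<Sum>i\<in>UNIV. g i (x $ i))"

definition objective ::
    "('a ^ 'n \<Rightarrow> real) \<Rightarrow> ('n::finite \<Rightarrow> 'a \<Rightarrow> real) \<Rightarrow> 'a ^ 'n \<Rightarrow> real" where
  "objective f g x = f x + separable_sum g x"

definition surrogate ::
    "('n \<Rightarrow> 'a \<Rightarrow> 'a ^ 'n \<Rightarrow> real) \<Rightarrow> ('n::finite \<Rightarrow> 'a \<Rightarrow> real) \<Rightarrow> 'n \<Rightarrow> 'a \<Rightarrow> 'a ^ 'n \<Rightarrow> real" where
  "surrogate ft g i z y = ft i z y + g i z"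

definition best_response ::
    "('n::finite \<Rightarrow> 'a set) \<Rightarrow> ('n \<Rightarrow> 'a \<Rightarrow> 'a ^ 'n \<Rightarrow> real) \<Rightarrow> ('n \<Rightarrow> 'a \<Rightarrow> real) \<Rightarrow> 'a ^ 'n \<Rightarrow> 'a ^ 'n" where
  "best_response X ft g y = (\<chi> i. arg_min_on (\<lambda>z. surrogate ft g i z y) (X i))"

definition prox_gradient ::
    "('n::finite \<Rightarrow> 'a::euclidean_space set) \<Rightarrow> ('a ^ 'n \<Rightarrow> 'a ^ 'n) \<Rightarrow> ('n \<Rightarrow> 'a \<Rightarrow> real)
      \<Rightarrow> 'a ^ 'n \<Rightarrow> 'a ^ 'n" where
  "prox_gradient X Df g x =
     x - arg_min_on (\<lambda>y. Df x \<bullet> (y - x) + separable_sum g y + 1 / 2 * (norm (y - x))\<^sup>2)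
           (block_prod X)"

definition psca_step ::
    "('n::finite \<Rightarrow> 'a::euclidean_space set) \<Rightarrow> ('n \<Rightarrow> 'a \<Rightarrow> 'a ^ 'n \<Rightarrow> real) \<Rightarrow> ('n \<Rightarrow> 'a \<Rightarrow> real)
      \<Rightarrow> real \<Rightarrow> 'n set \<Rightarrow> 'a ^ 'n \<Rightarrow> 'a ^ 'n" where
  "psca_step X ft g \<gamma> S x =
     (\<chi> i. if i \<in> S then x $ i + \<gamma> *\<^sub>R (best_response X ft g x $ i - x $ i) else x $ i)"

(* sigma(x^0, ..., x^r), as the pullback of the product sigma-algebra along (x^0, ..., x^r) *)
definition history ::
    "'w measure \<Rightarrow> (nat \<Rightarrow> 'w \<Rightarrow> 'b::euclidean_space) \<Rightarrow> nat \<Rightarrow> 'w measure" where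
  "history M x r =
     vimage_algebra (space M) (\<lambda>w. \<lambda>k\<in>{..r}. x k w) (\<Pi>\<^sub>M k\<in>{..r}. borel)"

definition accurate_at ::
    "'w measure \<Rightarrow> (nat \<Rightarrow> 'w \<Rightarrow> 'b::euclidean_space) \<Rightarrow> ('b \<Rightarrow> 'b) \<Rightarrow> real \<Rightarrow> nat \<Rightarrow> bool" where
  "accurate_at M x G \<epsilon> r \<longleftrightarrow> prob_space.expectation M (\<lambda>w. (norm (G (x r w)))\<^sup>2) \<le> \<epsilon>"

(* Meaningful only if some iteration is accurate. *)
definition first_accurate ::
    "'w measure \<Rightarrow> (nat \<Rightarrow> 'w \<Rightarrow> 'b::euclidean_space) \<Rightarrow> ('b \<Rightarrow> 'b) \<Rightarrow> real \<Rightarrow> nat" where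
  "first_accurate M x G \<epsilon> = (LEAST r. accurate_at M x G \<epsilon> r)"

end

theory Submission
  imports Defs
begin

text \<open>Up to the factor \<open>2 (L\<^sup>2 + 2 L + 2)\<close>, the squared norm of the proximal gradient is bounded
  by the squared length of the best-response step, and the expected sum of the latter along the
  iteration is at most \<open>(h x\<^sup>0 - h\<^sup>*) / \<beta>\<close> by the descent property. Hence \<open>\<epsilon>\<close> cannot be
  exceeded more than \<open>\<kappa> / \<epsilon>\<close> times. As \<open>x\<^sup>0\<close> is deterministic and there are finitely many
  choices of blocks, every iterate takes finitely many values, so all expectations exist.\<close>

section \<open>Convex functions on a subspace and existence of minimizers\<close>

text \<open>Convexity gives continuity on open sets, but \<open>V\<close> may have empty interior.
  Composing \<open>g\<close> with a linear map \<open>P\<close> onto \<open>V\<close> that fixes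
  \<open>V\<close> yields a convex function on the whole space that agrees with \<open>g\<close> on
  \<open>V\<close>.\<close>

lemma continuous_on_convex_subspace:
  fixes V :: "'a::euclidean_space set" and g :: "'a \<Rightarrow> real"
  assumes V: "subspace V" and g: "convex_on V g"
  shows "continuous_on V g"
proof -
  have "linear (\<lambda>x::'a. x)"
    by (simp add: linear_iff)
  then obtain P :: "'a \<Rightarrow> 'a" where P: "range P \<subseteq> V" "linear P" "\<forall>v\<in>V. P v = v"
    using linear_exists_left_inverse_on[of "\<lambda>x::'a. x" V] V by auto
  then have "convex_on UNIV (\<lambda>z. g (P z))"
    using g unfolding convex_on_def by (simp add: linear_add linear_scale image_subset_iff)
  then have "continuous_on UNIV (\<lambda>z. g (P z))"
    by (intro convex_on_continuous) simp_all
  then have "continuous_on V (\<lambda>z. g (P z))"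
    by (rule continuous_on_subset) simp
  then show ?thesis
    using P(3) by (simp cong: continuous_on_cong)
qed

text \<open>Along a ray from \<open>a\<close>, the average slope of a convex function does not
  decrease with the distance. Beyond distance 1 it is thus at least the slope at distance 1, which
  is at least \<open>g u - g a\<close> for a minimizer \<open>u\<close> over the unit ball, a
  compact set within \<open>V\<close>.\<close>

lemma convex_on_lower_bound:
  fixes V :: "'a::euclidean_space set" and g :: "'a \<Rightarrow> real"
  assumes V: "subspace V" and g: "convex_on V g" and a: "a \<in> V"
  obtains c where "0 \<le> c" "\<And>z. z \<in> V \<Longrightarrow> 1 \<le> norm (z - a) \<Longrightarrow> g a - c * norm (z - a) \<le> g z"
proof -
  have "closed V"
    using V by (rule closed_subspace)
  then have "compact (V \<inter> cball a 1)"
    by (simp add: closed_Int_compact)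
  moreover have "continuous_on (V \<inter> cball a 1) g"
    using continuous_on_convex_subspace[OF V g] continuous_on_subset by blast
  moreover have "V \<inter> cball a 1 \<noteq> {}"
    using a by auto
  ultimately obtain u where u: "u \<in> V \<inter> cball a 1" "\<forall>y\<in>V \<inter> cball a 1. g u \<le> g y"
    using continuous_attains_inf by meson
  show thesis
  proof (rule that[of "g a - g u"])
    show "0 \<le> g a - g u"
      using u(2) a by simp
    fix z assume z: "z \<in> V" "1 \<le> norm (z - a)"
    \<comment> \<open>This \<open>t\<close> puts the point \<open>y\<close> of the segment from
      \<open>a\<close> to \<open>z\<close> at distance exactly 1 from \<open>a\<close>.\<close>
    define t where "t = 1 / norm (z - a)"
    have t: "0 < t" "t \<le> 1"
      using z(2) by (auto simp: t_def divide_simps)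
    have tn: "t * norm (z - a) = 1"
      using z(2) by (auto simp: t_def)
    define y where "y = (1 - t) *\<^sub>R a + t *\<^sub>R z"
    have "y - a = t *\<^sub>R (z - a)"
      by (simp add: y_def algebra_simps)
    then have "norm (y - a) = 1"
      using t tn by simp
    moreover have "y \<in> V"
      unfolding y_def using V a z(1) by (intro subspace_add subspace_scale)
    ultimately have "g u \<le> g y"
      using u(2) by (simp add: dist_norm norm_minus_commute)
    also have "g y \<le> (1 - t) * g a + t * g z"
      unfolding y_def using convex_onD[OF g] t a z(1) by simp
    finally have "g u - g a \<le> t * (g z - g a)"
      by (simp add: algebra_simps)
    then have "norm (z - a) * (g u - g a) \<le> norm (z - a) * (t * (g z - g a))"
      by (intro mult_left_mono) simp_all
    also have "\<dots> = g z - g a"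
      using tn by (metis mult.assoc mult.commute mult.right_neutral)
    finally show "g a - (g a - g u) * norm (z - a) \<le> g z"
      by (simp add: algebra_simps)
  qed
qed

text \<open>A convex function decreases at most linearly, so the quadratic lower bound on
  \<^term>\<open>\<phi>\<close> makes \<^term>\<open>\<lambda>z. \<phi> z + g z\<close> coercive.\<close>

lemma composite_attains_inf:
  fixes S V :: "'a::euclidean_space set" and \<phi> g :: "'a \<Rightarrow> real"
  assumes V: "subspace V" and g: "convex_on V g"
    and S: "closed S" "S \<subseteq> V" "a \<in> S"
    and cont: "continuous_on S \<phi>"
    and t: "0 < t"
    and quad: "\<And>z. z \<in> S \<Longrightarrow> \<phi> a + d \<bullet> (z - a) + t / 2 * (norm (z - a))\<^sup>2 \<le> \<phi> z"
  obtains z where "z \<in> S" "\<And>y. y \<in> S \<Longrightarrow> \<phi> z + g z \<le> \<phi> y + g y"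
proof -
  obtain c where c: "0 \<le> c" "\<And>z. z \<in> V \<Longrightarrow> 1 \<le> norm (z - a) \<Longrightarrow> g a - c * norm (z - a) \<le> g z"
    using convex_on_lower_bound[OF V g, of a] S by blast
  \<comment> \<open>Beyond this radius the quadratic growth outweighs the linear loss of slope
    \<open>c + norm d\<close>, so values outside the ball are at least the value at
    \<open>a\<close>. The 1 keeps the linear bound on \<open>g\<close> applicable there.\<close>
  define R where "R = max 1 (2 * (c + norm d) / t)"
  have "compact (S \<inter> cball a R)"
    using S(1) by (simp add: closed_Int_compact)
  moreover have "continuous_on (S \<inter> cball a R) (\<lambda>z. \<phi> z + g z)"
    using continuous_on_convex_subspace[OF V g] cont S(2)
    by (intro continuous_on_add) (blast intro: continuous_on_subset)+
  moreover have aR: "a \<in> S \<inter> cball a R"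
    using S(3) by (simp add: R_def)
  ultimately obtain z where z: "z \<in> S \<inter> cball a R"
      "\<forall>y\<in>S \<inter> cball a R. \<phi> z + g z \<le> \<phi> y + g y"
    using continuous_attains_inf[of "S \<inter> cball a R"] by blast
  show thesis
  proof (rule that[of z])
    show "z \<in> S"
      using z(1) by simp
    fix y assume y: "y \<in> S"
    show "\<phi> z + g z \<le> \<phi> y + g y"
    proof (cases "y \<in> cball a R")
      case True
      then show ?thesis using z(2) y by blast
    next
      case False
      define n where "n = norm (y - a)"
      have n: "1 \<le> n" "2 * (c + norm d) / t \<le> n" "0 \<le> n"
        using False by (auto simp: R_def n_def dist_norm norm_minus_commute)
      have "c + norm d \<le> t / 2 * n"
        using n(2) t by (simp add: field_simps)
      then have "(c + norm d) * n \<le> t / 2 * n * n"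
        using n(3) by (rule mult_right_mono)
      moreover have "\<bar>d \<bullet> (y - a)\<bar> \<le> norm d * n"
        unfolding n_def by (rule Cauchy_Schwarz_ineq2)
      moreover have "g a - c * n \<le> g y"
        using c(2)[of y] y S(2) n(1) unfolding n_def by blast
      ultimately have "\<phi> a + g a \<le> \<phi> y + g y"
        using quad[OF y] unfolding n_def[symmetric] by (simp add: power2_eq_square algebra_simps)
      moreover have "\<phi> z + g z \<le> \<phi> a + g a"
        using z(2) aR by blast
      ultimately show ?thesis
        by linarith
    qed
  qed
qed

section \<open>First-order optimality of minimizers\<close>

text \<open>\<open>arg_min_on\<close> is a choice operator and returns a minimizer only if one
  exists; \<open>z\<close> certifies that.\<close>

lemma arg_min_on_attained:
  fixes F :: "'b \<Rightarrow> 'c::linorder"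
  assumes "z \<in> S" "\<And>y. y \<in> S \<Longrightarrow> F z \<le> F y"
  shows "arg_min_on F S \<in> S" "y \<in> S \<Longrightarrow> F (arg_min_on F S) \<le> F y"
proof -
  have "is_arg_min F (\<lambda>y. y \<in> S) (arg_min_on F S)"
    unfolding arg_min_on_def arg_min_def
    by (rule someI[of _ z]) (use assms in \<open>auto simp: is_arg_min_linorder\<close>)
  then show "arg_min_on F S \<in> S" "y \<in> S \<Longrightarrow> F (arg_min_on F S) \<le> F y"
    by (auto simp: is_arg_min_linorder)
qed

text \<open>Compare \<open>z\<close> with the points \<open>l t\<close> of the segment to
  \<open>y\<close>, divide the resulting inequality by \<open>t\<close>, and let \<open>t\<close>
  tend to 0, using the continuity of \<open>D\<close>.\<close>

lemma minimizer_variational_inequality: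
  fixes S :: "'a::euclidean_space set" and \<phi> g :: "'a \<Rightarrow> real"
  assumes S: "convex S" and g: "convex_on S g"
    and subgrad: "\<And>u v. u \<in> S \<Longrightarrow> v \<in> S \<Longrightarrow> \<phi> u + D u \<bullet> (v - u) \<le> \<phi> v"
    and D: "continuous_on S D"
    and z: "z \<in> S" "\<And>y. y \<in> S \<Longrightarrow> \<phi> z + g z \<le> \<phi> y + g y"
    and y: "y \<in> S"
  shows "0 \<le> D z \<bullet> (y - z) + g y - g z"
proof -
  define l where "l t = z + t *\<^sub>R (y - z)" for t :: real
  have l: "l t = (1 - t) *\<^sub>R z + t *\<^sub>R y" for t
    by (simp add: l_def algebra_simps)
  have lS: "l t \<in> S" if "0 \<le> t" "t \<le> 1" for t
    unfolding l using S z(1) y that by (intro convexD) simp_all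
  have pos: "0 \<le> D (l t) \<bullet> (y - z) + g y - g z" if t: "0 < t" "t \<le> 1" for t
  proof -
    \<comment> \<open>The subgradient inequality is taken at \<open>l t\<close> and tested at
      \<open>z\<close>: this direction bounds \<open>\<phi> (l t)\<close> from above.\<close>
    have "\<phi> (l t) + D (l t) \<bullet> (z - l t) \<le> \<phi> z"
      using subgrad lS z(1) t by simp
    moreover have "D (l t) \<bullet> (z - l t) = - t * (D (l t) \<bullet> (y - z))"
      by (simp add: l_def)
    moreover have "\<phi> z + g z \<le> \<phi> (l t) + g (l t)"
      using z(2) lS t by simp
    moreover have "g (l t) \<le> (1 - t) * g z + t * g y"
      unfolding l using convex_onD[OF g] t z(1) y by simp
    ultimately have "0 \<le> t * (D (l t) \<bullet> (y - z) + g y - g z)"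
      by (simp add: algebra_simps)
    then show ?thesis
      using t by (simp add: zero_le_mult_iff)
  qed
  have "continuous_on {0..1} l"
    unfolding l_def by (intro continuous_intros)
  then have "continuous_on {0..1} (\<lambda>t. D (l t))"
    using lS by (intro continuous_on_compose2[OF D]) auto
  then have "continuous_on {0..1} (\<lambda>t. D (l t) \<bullet> (y - z) + g y - g z)"
    by (intro continuous_intros)
  then have "((\<lambda>t. D (l t) \<bullet> (y - z) + g y - g z) \<longlongrightarrow> D (l 0) \<bullet> (y - z) + g y - g z)
      (at 0 within {0..1})"
    by (simp add: continuous_on_def)
  then have "0 \<le> D (l 0) \<bullet> (y - z) + g y - g z"
  proof (rule tendsto_lowerbound)
    show "\<forall>\<^sub>F t in at 0 within {0..1}. 0 \<le> D (l t) \<bullet> (y - z) + g y - g z"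
      \<comment> \<open>The filter leaves out \<open>t = 0\<close>, the one point of the interval
        about which \<open>pos\<close> says nothing.\<close>
      using pos by (auto simp: eventually_at_filter intro!: always_eventually)
    show "at (0::real) within {0..1} \<noteq> bot"
      by (simp add: at_within_Icc_at_right)
  qed
  then show ?thesis
    by (simp add: l_def)
qed

section \<open>Products of blocks\<close>

lemma norm_le_if_components_le:
  fixes a b :: "'a::real_inner ^ 'n"
  assumes "\<And>i. norm (a $ i) \<le> c * norm (b $ i)" "0 \<le> c"
  shows "norm a \<le> c * norm b"
proof -
  have "norm a \<le> L2_set (\<lambda>i. c * norm (b $ i)) UNIV"
    unfolding norm_vec_def by (intro L2_set_mono) (use assms in auto)
  also have "\<dots> = c * norm b"
    unfolding norm_vec_def using assms(2) by (rule L2_set_right_distrib[symmetric])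
  finally show ?thesis .
qed

lemma convex_on_separable_sum:
  fixes V :: "'n::finite \<Rightarrow> 'a::euclidean_space set"
  assumes "\<And>i. convex_on (V i) (g i)"
  shows "convex_on (block_prod V) (separable_sum g)"
  unfolding convex_on_def
proof (intro conjI ballI allI impI)
  show "convex (block_prod V)"
    using assms unfolding convex_def block_prod_def convex_on_def by simp
  fix x y :: "'a ^ 'n" and u v :: real
  assume "x \<in> block_prod V" "y \<in> block_prod V" "0 \<le> u" "0 \<le> v" "u + v = 1"
  then have "g i (u *\<^sub>R x $ i + v *\<^sub>R y $ i) \<le> u * g i (x $ i) + v * g i (y $ i)" for i
    using assms[of i] unfolding convex_on_def block_prod_def by simp
  then have "(\<Sum>i\<in>UNIV. g i (u *\<^sub>R x $ i + v *\<^sub>R y $ i))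
      \<le> (\<Sum>i\<in>UNIV. u * g i (x $ i) + v * g i (y $ i))"
    by (intro sum_mono)
  then show "separable_sum g (u *\<^sub>R x + v *\<^sub>R y) \<le> u * separable_sum g x + v * separable_sum g y"
    by (simp add: separable_sum_def sum.distrib sum_distrib_left)
qed

lemma closed_block_prod:
  fixes X :: "'n::finite \<Rightarrow> 'a::euclidean_space set"
  assumes "\<And>i. closed (X i)"
  shows "closed (block_prod X)"
proof -
  have "block_prod X = (\<Inter>i. (\<lambda>x. x $ i) -` X i)"
    by (auto simp: block_prod_def)
  moreover have "closed ((\<lambda>x::'a^'n. x $ i) -` X i)" for i
    using assms by (intro continuous_closed_vimage) (auto intro!: continuous_intros)
  ultimately show ?thesis
    by auto
qed

lemma subspace_block_prod:
  fixes V :: "'n::finite \<Rightarrow> 'a::euclidean_space set"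
  assumes "\<And>i. subspace (V i)"
  shows "subspace (block_prod V)"
  using assms by (auto simp: subspace_def block_prod_def)

lemma convex_block_prod:
  fixes X :: "'n::finite \<Rightarrow> 'a::euclidean_space set"
  assumes "\<And>i. convex (X i)"
  shows "convex (block_prod X)"
  using assms by (auto simp: convex_def block_prod_def)

section \<open>Best response and proximal point as genuine minimizers\<close>

lemma continuously_differentiable_imp_continuous_on:
  assumes "continuously_differentiable_with_gradient V S f Df"
  shows "continuous_on S f"
  using assms unfolding continuously_differentiable_with_gradient_def
  by (auto intro: has_derivative_continuous_on)

text \<open>Strong convexity at any fixed point of \<open>X i\<close> is the quadratic lower bound
  that makes the subproblem coercive. A minimum is therefore attained, and the choice made in
  \<open>best_response\<close> is a minimizer.\<close>

lemma best_response_minimizes: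
  fixes V X :: "'n::finite \<Rightarrow> 'a::euclidean_space set"
  assumes V: "subspace (V i)" and g: "convex_on (V i) (g i)"
    and X: "X i \<noteq> {}" "closed (X i)" "X i \<subseteq> V i"
    and smooth: "continuously_differentiable_with_gradient (V i) (X i) (\<lambda>z. ft i z y) (\<lambda>z. Dft i z y)"
    and tau: "0 < \<tau>"
    and strong: "\<And>z z'. z \<in> X i \<Longrightarrow> z' \<in> X i \<Longrightarrow>
          ft i z y \<ge> ft i z' y + Dft i z' y \<bullet> (z - z') + \<tau> / 2 * (norm (z - z'))\<^sup>2"
  shows "best_response X ft g y $ i \<in> X i"
    and "z \<in> X i \<Longrightarrow> surrogate ft g i (best_response X ft g y $ i) y \<le> surrogate ft g i z y"
proof -
  obtain a where a: "a \<in> X i"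
    using X(1) by blast
  obtain m where m: "m \<in> X i" "\<And>z. z \<in> X i \<Longrightarrow> ft i m y + g i m \<le> ft i z y + g i z"
    using composite_attains_inf[OF V g X(2,3) a
        continuously_differentiable_imp_continuous_on[OF smooth] tau] strong a
    by blast
  have "best_response X ft g y $ i = arg_min_on (\<lambda>z. surrogate ft g i z y) (X i)"
    by (simp add: best_response_def)
  then show "best_response X ft g y $ i \<in> X i"
    and "z \<in> X i \<Longrightarrow> surrogate ft g i (best_response X ft g y $ i) y \<le> surrogate ft g i z y"
    using arg_min_on_attained[of m "X i" "\<lambda>z. surrogate ft g i z y"] m
    unfolding surrogate_def by metis+
qed

text \<open>\<open>y\<close> is the proximal point itself. Its subproblem adds to
  \<open>separable_sum g\<close> a quadratic that is strongly convex with parameter 1 and has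
  gradient \<open>Df x + (u - x)\<close> at \<open>u\<close>; this yields both the existence of the
  minimizer and the inequality.\<close>

lemma prox_gradient_variational_inequality:
  fixes V X :: "'n::finite \<Rightarrow> 'a::euclidean_space set"
    and Df :: "'a ^ 'n \<Rightarrow> 'a ^ 'n"
  assumes V: "\<And>i. subspace (V i)" and g: "\<And>i. convex_on (V i) (g i)"
    and X: "\<And>i. closed (X i)" "\<And>i. convex (X i)" "\<And>i. X i \<subseteq> V i"
    and x: "x \<in> block_prod X"
  defines "y \<equiv> x - prox_gradient X Df g x"
  shows "y \<in> block_prod X"
    and "z \<in> block_prod X \<Longrightarrow>
      0 \<le> (Df x + (y - x)) \<bullet> (z - y) + separable_sum g z - separable_sum g y"
proof -
  let ?S = "block_prod X"
  define \<phi> where "\<phi> u = Df x \<bullet> (u - x) + 1 / 2 * (norm (u - x))\<^sup>2" for u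
  have gV: "convex_on (block_prod V) (separable_sum g)"
    using g by (rule convex_on_separable_sum)
  have SV: "?S \<subseteq> block_prod V"
    using X(3) by (auto simp: block_prod_def)
  have cS: "convex ?S"
    using X(2) by (rule convex_block_prod)
  have y: "y = arg_min_on (\<lambda>u. \<phi> u + separable_sum g u) ?S"
    unfolding y_def prox_gradient_def \<phi>_def by (simp add: algebra_simps)
  have cont: "continuous_on ?S \<phi>"
    unfolding \<phi>_def by (intro continuous_intros)
  \<comment> \<open>Expanded at \<open>x\<close>, where it vanishes, \<open>\<phi>\<close> meets the
    required lower bound with equality, for slope \<open>Df x\<close> and parameter 1.\<close>
  have "\<phi> x + Df x \<bullet> (u - x) + 1 / 2 * (norm (u - x))\<^sup>2 \<le> \<phi> u" for u
    by (simp add: \<phi>_def)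
  then obtain m where m: "m \<in> ?S" "\<And>u. u \<in> ?S \<Longrightarrow> \<phi> m + separable_sum g m \<le> \<phi> u + separable_sum g u"
    using composite_attains_inf[OF subspace_block_prod[OF V] gV closed_block_prod[OF X(1)] SV x cont,
        of 1 "Df x"] zero_less_one by metis
  note arg_min = arg_min_on_attained[of m ?S "\<lambda>u. \<phi> u + separable_sum g u"]
  show yS: "y \<in> ?S"
    unfolding y using m by (rule arg_min(1))
  have y_min: "\<phi> y + separable_sum g y \<le> \<phi> u + separable_sum g u" if "u \<in> ?S" for u
    unfolding y using m that by (rule arg_min(2))
  have subgrad: "\<phi> u + (Df x + (u - x)) \<bullet> (v - u) \<le> \<phi> v" for u v
  proof -
    have "\<phi> v - \<phi> u - (Df x + (u - x)) \<bullet> (v - u) = 1 / 2 * (norm (v - u))\<^sup>2"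
      unfolding \<phi>_def power2_norm_eq_inner by (simp add: algebra_simps inner_commute)
    moreover have "0 \<le> 1 / 2 * (norm (v - u))\<^sup>2"
      by simp
    ultimately show ?thesis
      by linarith
  qed
  have gS: "convex_on ?S (separable_sum g)"
    using gV SV cS by (rule convex_on_subset)
  show "0 \<le> (Df x + (y - x)) \<bullet> (z - y) + separable_sum g z - separable_sum g y" if "z \<in> ?S"
  proof (rule minimizer_variational_inequality[OF cS gS _ _ yS y_min that])
    show "continuous_on ?S (\<lambda>u. Df x + (u - x))"
      by (intro continuous_intros)
  qed (use subgrad in auto)
qed

section \<open>The proximal gradient against the best-response step\<close>

text \<open>The variational inequalities of the proximal point \<^term>\<open>x - prox_gradient X Df g x\<close> and of
  the best response, each tested at the other point, add up to an inequality free of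
  \<^term>\<open>g\<close>. By gradient consistency, it involves the gradients only through the increment
  \<open>a\<close> of the surrogate gradient along the best-response step, to which the Lipschitz
  constants and monotonicity apply. A negative \<^term>\<open>L\<close> can only occur if the step vanishes.\<close>

lemma norm_prox_gradient_le:
  fixes V X :: "'n::finite \<Rightarrow> 'a::euclidean_space set"
    and ft :: "'n \<Rightarrow> 'a \<Rightarrow> 'a ^ 'n \<Rightarrow> real" and Li :: "'n \<Rightarrow> real"
  assumes V: "\<And>i. subspace (V i)" and g: "\<And>i. convex_on (V i) (g i)"
    and X: "\<And>i. X i \<noteq> {}" "\<And>i. closed (X i)" "\<And>i. convex (X i)" "\<And>i. X i \<subseteq> V i"
    and x: "x \<in> block_prod X"
    and smooth: "\<And>i. continuously_differentiable_with_gradient (V i) (X i) (\<lambda>z. ft i z x) (\<lambda>z. Dft i z x)"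
    and tau: "0 < \<tau>"
    and strong: "\<And>i z z'. z \<in> X i \<Longrightarrow> z' \<in> X i \<Longrightarrow>
          ft i z x \<ge> ft i z' x + Dft i z' x \<bullet> (z - z') + \<tau> / 2 * (norm (z - z'))\<^sup>2"
    and consistent: "\<And>i. Dft i (x $ i) x = Df x $ i"
    and Lipschitz: "\<And>i z z'. z \<in> X i \<Longrightarrow> z' \<in> X i \<Longrightarrow>
          norm (Dft i z x - Dft i z' x) \<le> Li i * norm (z - z')"
  defines "L \<equiv> Max (range Li)"
  shows "(norm (prox_gradient X Df g x))\<^sup>2
    \<le> 2 * (L\<^sup>2 + 2 * L + 2) * (norm (best_response X ft g x - x))\<^sup>2"
proof -
  define b where "b = best_response X ft g x"
  define G where "G = prox_gradient X Df g x"
  define y where "y = x - G"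
  define d where "d = b - x"
  define a :: "'a ^ 'n" where "a = (\<chi> i. Dft i (b $ i) x - Df x $ i)"
  have convex_ft: "ft i z' x + Dft i z' x \<bullet> (z - z') \<le> ft i z x" if "z \<in> X i" "z' \<in> X i" for i z z'
  proof -
    have "0 \<le> \<tau> / 2 * (norm (z - z'))\<^sup>2"
      using tau by simp
    then show ?thesis
      using strong[OF that] by linarith
  qed
  have xi: "x $ i \<in> X i" for i
    using x by (simp add: block_prod_def)
  note best = best_response_minimizes[where V=V and X=X and g=g and ft=ft and Dft=Dft and y=x and \<tau>=\<tau>]
  have bi: "b $ i \<in> X i" for i
    unfolding b_def by (rule best(1)) (fact V g X smooth tau strong)+
  have b_min: "ft i (b $ i) x + g i (b $ i) \<le> ft i z x + g i z" if "z \<in> X i" for i z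
    unfolding b_def surrogate_def[symmetric]
    by (rule best(2)) (fact V g X smooth tau strong that)+
  note prox = prox_gradient_variational_inequality[where Df=Df, OF V g X(2,3,4) x]
  have yS: "y \<in> block_prod X"
    using prox(1) unfolding y_def G_def .
  have VI_b: "0 \<le> Dft i (b $ i) x \<bullet> (y $ i - b $ i) + g i (y $ i) - g i (b $ i)" for i
  proof (rule minimizer_variational_inequality[OF X(3) _ convex_ft _ bi b_min])
    show "convex_on (X i) (g i)"
      using g X(3,4) by (blast intro: convex_on_subset)
    show "continuous_on (X i) (\<lambda>z. Dft i z x)"
      using smooth unfolding continuously_differentiable_with_gradient_def by blast
    show "y $ i \<in> X i"
      using yS by (simp add: block_prod_def)
  qed
  have "Dft i (b $ i) x = (Df x + a) $ i" for i
    by (simp add: a_def)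
  then have "0 \<le> (Df x + a) $ i \<bullet> (y - b) $ i + g i (y $ i) - g i (b $ i)" for i
    using VI_b[of i] by simp
  then have "0 \<le> (\<Sum>i\<in>UNIV. (Df x + a) $ i \<bullet> (y - b) $ i + g i (y $ i) - g i (b $ i))"
    by (intro sum_nonneg) blast
  then have "0 \<le> (Df x + a) \<bullet> (y - b) + separable_sum g y - separable_sum g b"
    by (simp only: inner_vec_def separable_sum_def sum.distrib sum_subtractf)
  moreover have "0 \<le> (Df x - G) \<bullet> (b - y) + separable_sum g b - separable_sum g y"
    using prox(2)[of b] bi unfolding y_def G_def by (simp add: block_prod_def)
  \<comment> \<open>Since \<open>y - b = - (G + d)\<close>, this is
    \<open>- ((a + G) \<bullet> (G + d))\<close>; \<open>Df x\<close> cancels because the two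
    inequalities are tested in opposite directions.\<close>
  moreover have "(Df x + a) \<bullet> (y - b) + (Df x - G) \<bullet> (b - y) = - (a \<bullet> G) - a \<bullet> d - G \<bullet> G - G \<bullet> d"
    by (simp add: y_def d_def algebra_simps inner_commute)
  ultimately have key: "G \<bullet> G + a \<bullet> d \<le> - (a \<bullet> G) - G \<bullet> d"
    by linarith
  \<comment> \<open>Monotonicity of the surrogate gradient, by adding the two convexity inequalities
    between \<open>x $ i\<close> and \<open>b $ i\<close>.\<close>
  have "0 \<le> a $ i \<bullet> d $ i" for i
    using convex_ft[OF xi[of i] bi[of i]] convex_ft[OF bi[of i] xi[of i]]
    by (simp add: a_def d_def consistent algebra_simps)
  then have "0 \<le> a \<bullet> d"
    unfolding inner_vec_def by (intro sum_nonneg) blast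
  then have "norm G * norm G \<le> - (a \<bullet> G) - G \<bullet> d"
    using key by (simp add: norm_eq_sqrt_inner)
  also have "\<dots> \<le> (norm a + norm d) * norm G"
    using Cauchy_Schwarz_ineq2[of a G] Cauchy_Schwarz_ineq2[of G d] by (simp add: algebra_simps)
  finally have "norm G \<le> norm a + norm d"
    by (cases "G = 0") simp_all
  then have "(norm G)\<^sup>2 \<le> (norm a + norm d)\<^sup>2"
    by (intro power_mono) simp_all
  also have "\<dots> \<le> 2 * (norm a)\<^sup>2 + 2 * (norm d)\<^sup>2"
    using sum_squares_bound[of "norm a" "norm d"] by (simp add: power2_sum)
  finally have G: "(norm G)\<^sup>2 \<le> 2 * (norm a)\<^sup>2 + 2 * (norm d)\<^sup>2" .
  have ai: "norm (a $ i) \<le> L * norm (d $ i)" for i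
  proof -
    have "norm (a $ i) \<le> Li i * norm (d $ i)"
      using Lipschitz[OF bi[of i] xi[of i]] by (simp add: a_def d_def consistent)
    also have "\<dots> \<le> L * norm (d $ i)"
      unfolding L_def by (intro mult_right_mono Max_ge) simp_all
    finally show ?thesis .
  qed
  have "(norm G)\<^sup>2 \<le> 2 * (L\<^sup>2 + 2 * L + 2) * (norm d)\<^sup>2"
  proof (cases "0 \<le> L")
    case True
    have "norm a \<le> L * norm d"
      using ai True by (rule norm_le_if_components_le)
    then have "(norm a)\<^sup>2 \<le> L\<^sup>2 * (norm d)\<^sup>2"
      using power_mono[of "norm a" "L * norm d" 2] by (simp add: power_mult_distrib)
    \<comment> \<open>The estimates so far give the sharper factor
      \<open>2 * (L\<^sup>2 + 1)\<close>; twice this nonnegative term is the slack up to the stated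
      one.\<close>
    moreover have "0 \<le> (2 * L + 1) * (norm d)\<^sup>2"
      using True by simp
    ultimately show ?thesis
      using G by (simp add: algebra_simps)
  next
    case False
    have d0: "d $ i = 0" for i
    proof (rule ccontr)
      assume "d $ i \<noteq> 0"
      then have "L * norm (d $ i) < 0"
        using False by (simp add: mult_neg_pos)
      then show False
        using ai[of i] norm_ge_zero[of "a $ i"] by linarith
    qed
    then have "a $ i = 0" for i
      using ai[of i] by simp
    with d0 have "a = 0" "d = 0"
      by (simp_all add: vec_eq_iff)
    then show ?thesis
      using G by simp
  qed
  then show ?thesis
    by (simp add: G_def d_def b_def)
qed

section \<open>Feasibility and integrability of the iterates\<close>

lemma psca_step_in_block_prod:
  fixes X :: "'n::finite \<Rightarrow> 'a::euclidean_space set"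
  assumes X: "\<And>i. convex (X i)" and x: "x \<in> block_prod X"
    and b: "best_response X ft g x \<in> block_prod X" and gamma: "0 \<le> \<gamma>" "\<gamma> \<le> 1"
  shows "psca_step X ft g \<gamma> T x \<in> block_prod X"
proof -
  have "x $ i + \<gamma> *\<^sub>R (best_response X ft g x $ i - x $ i) \<in> X i" for i
  proof -
    have "(1 - \<gamma>) *\<^sub>R x $ i + \<gamma> *\<^sub>R best_response X ft g x $ i \<in> X i"
      using X x b gamma by (intro convexD) (simp_all add: block_prod_def)
    then show ?thesis
      by (simp add: algebra_simps)
  qed
  then show ?thesis
    using x by (simp add: psca_step_def block_prod_def)
qed

text \<open>Finitely many outcomes of \<open>S r\<close> applied to finitely many values of
  \<open>x r\<close> give finitely many values of the next iterate. \<open>F\<close> is arbitrary,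
  which covers an update defined through a choice of minimizers.\<close>

lemma simple_function_random_recursion:
  fixes x :: "nat \<Rightarrow> 'w \<Rightarrow> 'b" and S :: "nat \<Rightarrow> 'w \<Rightarrow> 'c::finite"
  assumes S: "\<And>r. S r \<in> measurable M (count_space UNIV)"
    and x0: "\<And>w. w \<in> space M \<Longrightarrow> x 0 w = a"
    and step: "\<And>r w. w \<in> space M \<Longrightarrow> x (Suc r) w = F (S r w) (x r w)"
  shows "simple_function M (x r)"
proof (induction r)
  case 0
  show ?case
    using x0 by (simp cong: simple_function_cong)
next
  case (Suc r)
  have "simple_function M (S r)"
    unfolding simple_function_def
    using S[of r] by (auto intro: measurable_sets[OF S[of r]] simp: Int_commute)
  then have "simple_function M (\<lambda>w. F (S r w) (x r w))"
    using Suc by (rule simple_function_compose2)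
  then show ?case
    using step by (simp cong: simple_function_cong)
qed

lemma (in finite_measure) integrable_if_simple_function:
  fixes f :: "'a \<Rightarrow> 'b::{banach, second_countable_topology}"
  assumes "simple_function M f"
  shows "integrable M f"
  using assms by (intro integrable_simple_function) (simp_all add: emeasure_eq_measure)

text \<open>By the tower property, \<open>H\<close> and its conditional expectation have the same
  expectation. Measurability of \<open>Y\<close> makes the sigma-algebra it generates a subalgebra
  of \<open>M\<close>.\<close>

lemma (in prob_space) expectation_le_if_cond_exp_le:
  assumes Y: "Y \<in> measurable M N" and H: "integrable M H" and U: "integrable M U"
    and le: "AE w in M. real_cond_exp M (vimage_algebra (space M) Y N) H w \<le> U w"
  shows "expectation H \<le> expectation U"
proof -
  let ?F = "vimage_algebra (space M) Y N"
  have "subalgebra M ?F"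
    unfolding subalgebra_def using Y
    by (auto simp: sets_vimage_algebra2 measurable_space measurable_sets[OF Y])
  then have "finite_measure_subalgebra M ?F"
    by unfold_locales
  then interpret sigma_finite_subalgebra M ?F
    by (rule finite_measure_subalgebra_is_sigma_finite)
  show ?thesis
    using integral_mono_AE[OF real_cond_exp_int(1)[OF H] U le] real_cond_exp_int(2)[OF H]
    by simp
qed

section \<open>The iteration bound\<close>

theorem theorem3:
  fixes V X :: "'n::finite \<Rightarrow> 'a::euclidean_space set"
    and f :: "'a ^ 'n \<Rightarrow> real" and Df :: "'a ^ 'n \<Rightarrow> 'a ^ 'n"
    and g :: "'n \<Rightarrow> 'a \<Rightarrow> real"
    and ft :: "'n \<Rightarrow> 'a \<Rightarrow> 'a ^ 'n \<Rightarrow> real" and Dft :: "'n \<Rightarrow> 'a \<Rightarrow> 'a ^ 'n \<Rightarrow> 'a"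
    and Lf \<tau> Lt \<gamma> pmin \<beta> \<epsilon> :: real and Li :: "'n \<Rightarrow> real"
    and M :: "'w measure"
    and x0 :: "'a ^ 'n" and x :: "nat \<Rightarrow> 'w \<Rightarrow> 'a ^ 'n"
    and S :: "nat \<Rightarrow> 'w \<Rightarrow> 'n set" and p :: "nat \<Rightarrow> 'n \<Rightarrow> 'w \<Rightarrow> real"
  defines "h \<equiv> objective f g"
    and "XX \<equiv> block_prod X"
    and "xhat \<equiv> best_response X ft g"
    and "G \<equiv> prox_gradient X Df g"
    and "L \<equiv> Max (range Li)"
  assumes V: "\<And>i. subspace (V i)"
    and X: "\<And>i. X i \<noteq> {}" "\<And>i. closed (X i)" "\<And>i. convex (X i)" "\<And>i. X i \<subseteq> V i"
    and f_smooth: "continuously_differentiable_with_gradient (block_prod V) XX f Df"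
    and g_convex: "\<And>i. convex_on (V i) (g i)"
    and Lf: "0 < Lf" "\<And>u v. u \<in> XX \<Longrightarrow> v \<in> XX \<Longrightarrow> norm (Df u - Df v) \<le> Lf * norm (u - v)"
    and h_bounded: "bdd_below (h ` XX)"
    and ft_smooth: "\<And>i y. y \<in> XX \<Longrightarrow>
          continuously_differentiable_with_gradient (V i) (X i) (\<lambda>z. ft i z y) (\<lambda>z. Dft i z y)"
    and tau: "0 < \<tau>"
    and ft_strongly_convex: "\<And>i z z' y. z \<in> X i \<Longrightarrow> z' \<in> X i \<Longrightarrow> y \<in> XX \<Longrightarrow>
          ft i z y \<ge> ft i z' y + Dft i z' y \<bullet> (z - z') + \<tau> / 2 * (norm (z - z'))\<^sup>2"
    and ft_consistent: "\<And>i u. u \<in> XX \<Longrightarrow> Dft i (u $ i) u = Df u $ i"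
    and ft_Lipschitz_snd: "\<And>i z y y'. z \<in> X i \<Longrightarrow> y \<in> XX \<Longrightarrow> y' \<in> XX \<Longrightarrow>
          norm (Dft i z y - Dft i z y') \<le> Lt * norm (y - y')"
    and ft_Lipschitz_fst: "\<And>i z z' y. z \<in> X i \<Longrightarrow> z' \<in> X i \<Longrightarrow> y \<in> XX \<Longrightarrow>
          norm (Dft i z y - Dft i z' y) \<le> Li i * norm (z - z')"
    and gamma: "0 < \<gamma>" "\<gamma> \<le> 1" "\<gamma> < \<tau> / Lf"
    and M: "prob_space M"
    and S_measurable: "\<And>r. S r \<in> measurable M (count_space UNIV)"
    and x0: "x0 \<in> XX" "\<And>w. w \<in> space M \<Longrightarrow> x 0 w = x0"
    and x_step: "\<And>r w. w \<in> space M \<Longrightarrow> x (Suc r) w = psca_step X ft g \<gamma> (S r w) (x r w)"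
    and pmin: "0 < pmin" "\<And>r j w. w \<in> space M \<Longrightarrow> pmin \<le> p r j w"
    and S_prob: "\<And>r j. AE w in M.
          real_cond_exp M (history M x r) (indicat_real {w \<in> space M. j \<in> S r w}) w = p r j w"
    and beta: "0 < \<beta>"
    and descent: "\<And>r. AE w in M.
          real_cond_exp M (vimage_algebra (space M) (x r) borel) (\<lambda>w. h (x (Suc r) w)) w
            \<le> h (x r w) - \<beta> * (norm (xhat (x r w) - x r w))\<^sup>2"
    and eps: "0 < \<epsilon>"
  shows "(\<exists>r. accurate_at M x G \<epsilon> r) \<and>
         real (first_accurate M x G \<epsilon>)
           \<le> (2 * (L\<^sup>2 + 2 * L + 2) * (h x0 - (INF y\<in>XX. h y)) / \<beta>) / \<epsilon>"
proof -
  interpret prob_space M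
    by (rule M)
  define \<kappa> where "\<kappa> = 2 * (L\<^sup>2 + 2 * L + 2) * (h x0 - (INF y\<in>XX. h y)) / \<beta>"
  define C where "C = 2 * (L\<^sup>2 + 2 * L + 2)"
  define e where "e r = expectation (\<lambda>w. (norm (xhat (x r w) - x r w))\<^sup>2)" for r
  \<comment> \<open>Completing the square makes \<open>C\<close> positive whatever the sign of
    \<open>L\<close>.\<close>
  have "C = 2 * (L + 1)\<^sup>2 + 2"
    by (simp add: C_def power2_eq_square algebra_simps)
  then have C: "0 < C"
    using zero_le_power2[of "L + 1"] by linarith
  have xhat: "xhat u \<in> XX" if u: "u \<in> XX" for u
  proof -
    have "xhat u $ i \<in> X i" for i
      unfolding xhat_def
      by (rule best_response_minimizes(1)[where V=V and Dft=Dft and \<tau>=\<tau>])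
        (fact V g_convex X ft_smooth[OF u] tau ft_strongly_convex[OF _ _ u])+
    then show ?thesis
      by (simp add: XX_def block_prod_def)
  qed
  have xX: "x r w \<in> XX" if w: "w \<in> space M" for r w
  proof (induction r)
    case 0
    show ?case
      using x0 w by simp
  next
    case (Suc r)
    then show ?case
      using psca_step_in_block_prod[OF X(3), of "x r w"] xhat[of "x r w"] gamma x_step[OF w]
      unfolding XX_def xhat_def by simp
  qed
  have G_le: "(norm (G u))\<^sup>2 \<le> C * (norm (xhat u - u))\<^sup>2" if "u \<in> XX" for u
    unfolding G_def C_def xhat_def L_def using that
    by (intro norm_prox_gradient_le[where V=V and Dft=Dft and \<tau>=\<tau>] V g_convex X ft_smooth tau
        ft_strongly_convex ft_consistent ft_Lipschitz_fst) (simp_all add: XX_def)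
  have simple: "simple_function M (x r)" for r
    using S_measurable x0(2) x_step by (rule simple_function_random_recursion)
  then have int: "integrable M (\<lambda>w. F (x r w))" for F :: "'a ^ 'n \<Rightarrow> real" and r
    by (intro integrable_if_simple_function simple_function_compose1[where g=F])
  have "x r \<in> borel_measurable M" for r
    using simple by (rule borel_measurable_simple_function)
  then have mean: "expectation (\<lambda>w. h (x (Suc r) w))
      \<le> expectation (\<lambda>w. h (x r w) - \<beta> * (norm (xhat (x r w) - x r w))\<^sup>2)" for r
    using int[of h] int[of "\<lambda>u. h u - \<beta> * (norm (xhat u - u))\<^sup>2"] descent
    by (rule expectation_le_if_cond_exp_le)
  have step: "expectation (\<lambda>w. h (x (Suc r) w)) \<le> expectation (\<lambda>w. h (x r w)) - \<beta> * e r" for r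
    using mean[of r] int[of h r] int[of "\<lambda>u. (norm (xhat u - u))\<^sup>2" r] by (simp add: e_def)
  have "expectation (\<lambda>w. h (x 0 w)) = expectation (\<lambda>w. h x0)"
    using x0(2) by (intro Bochner_Integration.integral_cong) simp_all
  then have E0: "expectation (\<lambda>w. h (x 0 w)) = h x0"
    by (simp add: prob_space)
  \<comment> \<open>The expected decreases over the first \<open>N\<close> steps add up; together
    with \<open>lower\<close>, this bounds their total independently of \<open>N\<close>.\<close>
  have telescope: "expectation (\<lambda>w. h (x N w)) + \<beta> * (\<Sum>r<N. e r) \<le> h x0" for N
  proof (induction N)
    case 0
    show ?case
      using E0 by simp
  next
    case (Suc N)
    then show ?case
      using step[of N] by (simp add: algebra_simps)
  qed
  have lower: "(INF y\<in>XX. h y) \<le> expectation (\<lambda>w. h (x N w))" for N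
    using int[of h N] xX by (intro integral_ge_const AE_I2 cINF_lower h_bounded)
  \<comment> \<open>Stated for any initial run of \<open>N\<close> inaccurate iterations, so that it
    serves twice: for all \<open>N\<close> at once it refutes that no iteration is accurate, and for
    the first accurate index it is the claimed bound.\<close>
  have bound: "real N \<le> \<kappa> / \<epsilon>" if "\<And>r. r < N \<Longrightarrow> \<not> accurate_at M x G \<epsilon> r" for N
  proof -
    have "\<epsilon> \<le> C * e r" if "r < N" for r
    proof -
      have "\<epsilon> \<le> expectation (\<lambda>w. (norm (G (x r w)))\<^sup>2)"
        using \<open>\<And>r. r < N \<Longrightarrow> \<not> accurate_at M x G \<epsilon> r\<close>[OF that] by (simp add: accurate_at_def)
      also have "\<dots> \<le> expectation (\<lambda>w. C * (norm (xhat (x r w) - x r w))\<^sup>2)"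
        using int[of "\<lambda>u. (norm (G u))\<^sup>2" r] int[of "\<lambda>u. C * (norm (xhat u - u))\<^sup>2" r] G_le xX
        by (intro integral_mono) simp_all
      finally show ?thesis
        by (simp add: e_def)
    qed
    then have "(\<Sum>r<N. \<epsilon>) \<le> (\<Sum>r<N. C * e r)"
      by (intro sum_mono) simp
    then have "\<beta> * (real N * \<epsilon>) \<le> \<beta> * (C * (\<Sum>r<N. e r))"
      using beta by (intro mult_left_mono) (simp_all add: sum_distrib_left)
    also have "\<dots> = C * (\<beta> * (\<Sum>r<N. e r))"
      by simp
    also have "\<dots> \<le> C * (h x0 - (INF y\<in>XX. h y))"
      using telescope[of N] lower[of N] C by (intro mult_left_mono) simp_all
    finally show ?thesis
      using beta eps unfolding \<kappa>_def C_def[symmetric] by (simp add: field_simps)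
  qed
  have ex: "\<exists>r. accurate_at M x G \<epsilon> r"
  proof (rule ccontr)
    assume "\<not> ?thesis"
    then have "real N \<le> \<kappa> / \<epsilon>" for N
      using bound by blast
    then show False
      using reals_Archimedean2[of "\<kappa> / \<epsilon>"] by (meson not_le)
  qed
  \<comment> \<open>Indices start at 0, so the number of inaccurate iterations before the first
    accurate one equals its index, and no 1 has to be added.\<close>
  moreover have "real (first_accurate M x G \<epsilon>) \<le> \<kappa> / \<epsilon>"
    using not_less_Least by (intro bound) (auto simp: first_accurate_def)
  ultimately show ?thesis
    unfolding \<kappa>_def by blast
qed

end
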